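(* Let $X \in \mathbb{R}^{n\times d}$ be a fixed matrix of full rank $d \wedge n$, let $R$ be a random $d \times k$ matrix, independent of the noise $\xi$, and write $X_R = XR$. Let $r \in \{1,\ldots,d\wedge n\}$, and suppose that: (C1) $R$ is a $(2nr,\ \varepsilon_1/\sqrt{r},\ \delta_1)$-JLT; (C2) $R$ is an $(r, \varepsilon_2, \delta_2)$-restricted isometry. Then with probability at least $1-\delta_1-\delta_2$ (with respect to $R$), $$\|(I - P_{X_R})X\|_F^2 \;\le\; \left(1 + \frac{\varepsilon_1^2}{(1-\varepsilon_2)^4}\right)\|\Delta_r\|_F^2 .$$ Moreover, conditional on this event (i.e. whenever $R$ is such that the preceding inequality holds), the excess risk satisfies $$\mathcal{E}(R) \;\le\; \left(1 + \frac{\varepsilon_1^2}{(1-\varepsilon_2)^4}\right)\|w^*\|_2^2\,\frac{\|\Delta_r\|_F^2}{n} + \sigma^2\,\frac{k}{n}.$$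
   Context: Model: $y = f + \xi \in \mathbb{R}^n$ with $f \in \mathbb{R}^n$ deterministic and $\xi = (\xi_1,\dots,\xi_n)$ having uncorrelated entries with mean zero and variance $\sigma^2$. For a matrix $M$, $P_M$ denotes the orthogonal projection onto the column space of $M$, and $\|\cdot\|_F$ is the Frobenius norm. $w^* \in \mathbb{R}^d$ is the vector of minimum $\ell_2$-norm satisfying $Xw^* = P_X f$. Excess risk: for a $d\times k$ matrix $R$, $\mathcal{E}(R) = \mathbf{E}_\xi\big[\|Xw^* - X_R \widehat{w}_R\|_2^2/n\big]$, where $X_R = XR$, $\widehat w_R$ is a least squares solution for response $y$ and design $X_R$, i.e. $X_R\widehat w_R = P_{X_R}y$, and the expectation is over $\xi$ only ($R$ is held fixed). $\Delta_r = X - \mathcal{T}_r(X)$, where $\mathcal{T}_r(X)$ is the best rank-$r$ approximation of $X$ in Frobenius norm given by the $r$-truncated singular value decomposition of $X$. Definition (JLT). A random $d\times k$ matrix $R$ is an $(m,\varepsilon,\delta)$-JLT, for $\varepsilon,\delta\in(0,1)$, if for every fixed set of $m$ points $\{v_1,\ldots,v_m\}\subset\mathbb{R}^d$, with probability at least $1-\delta$, $(1-\varepsilon)\|v_i\|_2^2 \le \|R^\top v_i\|_2^2 \le (1+\varepsilon)\|v_i\|_2^2$ for all $i=1,\ldots,m$. Definition (restricted isometry). A random $d\times k$ matrix $R$ is an $(s,\varepsilon,\delta)$-restricted isometry, for $\varepsilon,\delta\in(0,1)$, if for every fixed subspace $\mathcal{V}\subset\mathbb{R}^d$ of dimension $s$,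 with probability at least $1-\delta$, $(1-\varepsilon)\|v\|_2 \le \|R^\top v\|_2 \le (1+\varepsilon)\|v\|_2$ for all $v\in\mathcal{V}$. *)

theory Defs
  imports "HOL-Probability.Probability"
begin

definition proj_mat :: "real^'m^'n \<Rightarrow> real^'n^'n" where
  "proj_mat A = matrix (\<lambda>x. THE p. p \<in> span (columns A) \<and>
     (\<forall>z \<in> span (columns A). orthogonal (x - p) z))"

lemma ex1_orthogonal_projection:
  fixes S :: "'a::euclidean_space set"
  shows "\<exists>!p. p \<in> span S \<and> (\<forall>z \<in> span S. orthogonal (x - p) z)"
proof -
  obtain p q where "p \<in> span S" "\<And>w. w \<in> span S \<Longrightarrow> orthogonal q w" "x = p + q"
    using orthogonal_subspace_decomp_exists by blast
  then have ex: "p \<in> span S \<and> (\<forall>z \<in> span S. orthogonal (x - p) z)" by simp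
  have "p' = p" if "p' \<in> span S \<and> (\<forall>z \<in> span S. orthogonal (x - p') z)" for p'
  proof -
    have "p' - p \<in> span S" using that ex by (simp add: span_diff)
    then have "(x - p) \<bullet> (p' - p) = 0" "(x - p') \<bullet> (p' - p) = 0"
      using that ex by (auto simp: orthogonal_def)
    then have "(p' - p) \<bullet> (p' - p) = 0" by (simp add: inner_diff_left)
    then show ?thesis by simp
  qed
  with ex show ?thesis by blast
qed

lemma proj_mat:
  fixes A :: "real^'m^'n"
  shows "proj_mat A *v x \<in> span (columns A)"
    and "z \<in> span (columns A) \<Longrightarrow> orthogonal (x - proj_mat A *v x) z"
proof -
  define Q where "Q x p \<longleftrightarrow> p \<in> span (columns A) \<and>
     (\<forall>z \<in> span (columns A). orthogonal (x - p) z)" for x p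
  define P where "P x = (THE p. Q x p)" for x
  have ex1: "\<exists>!p. Q x p" for x unfolding Q_def by (rule ex1_orthogonal_projection)
  have P: "Q x (P x)" for x unfolding P_def using theI'[OF ex1] .
  have eq: "P x = p" if "Q x p" for x p using ex1 P that by blast
  have "linear P"
  proof (rule linearI)
    fix x y show "P (x + y) = P x + P y"
    proof (rule eq)
      have *: "x + y - (P x + P y) = (x - P x) + (y - P y)" by simp
      show "Q (x + y) (P x + P y)" using P[of x] P[of y]
        unfolding Q_def * by (auto intro: span_add simp: orthogonal_def inner_add_left)
    qed
  next
    fix c :: real and x show "P (c *\<^sub>R x) = c *\<^sub>R P x"
    proof (rule eq)
      have *: "c *\<^sub>R x - c *\<^sub>R P x = c *\<^sub>R (x - P x)" by (simp add: scaleR_diff_right)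
      show "Q (c *\<^sub>R x) (c *\<^sub>R P x)" using P[of x]
        unfolding Q_def * by (auto intro: span_scale simp: orthogonal_def)
    qed
  qed
  then have "proj_mat A *v x = P x" for x
    unfolding proj_mat_def P_def[abs_def] Q_def by (simp add: matrix_works)
  then show "proj_mat A *v x \<in> span (columns A)"
    and "z \<in> span (columns A) \<Longrightarrow> orthogonal (x - proj_mat A *v x) z"
    using P[of x] by (auto simp: Q_def)
qed

text \<open>The norm of the type \<open>real^'m^'n\<close> is the Frobenius norm.\<close>

lemma norm_matrix_Frobenius:
  fixes A :: "real^'m^'n"
  shows "norm A = sqrt (\<Sum>i\<in>UNIV. \<Sum>j\<in>UNIV. (A $ i $ j)\<^sup>2)"
  by (simp add: norm_vec_def L2_set_def sum_nonneg)

definition outer_prod :: "real^'n \<Rightarrow> real^'m \<Rightarrow> real^'m^'n" where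
  "outer_prod u v = (\<chi> i j. u $ i * v $ j)"

definition is_svd ::
  "real^'d^'n \<Rightarrow> (nat \<Rightarrow> real^'n) \<Rightarrow> (nat \<Rightarrow> real) \<Rightarrow> (nat \<Rightarrow> real^'d) \<Rightarrow> bool" where
  "is_svd X u s v \<longleftrightarrow>
     (let p = min CARD('d) CARD('n) in
       (\<forall>i<p. \<forall>j<p. u i \<bullet> u j = (if i = j then 1 else 0)) \<and>
       (\<forall>i<p. \<forall>j<p. v i \<bullet> v j = (if i = j then 1 else 0)) \<and>
       (\<forall>i<p. 0 \<le> s i) \<and>
       (\<forall>i<p. \<forall>j<p. i \<le> j \<longrightarrow> s j \<le> s i) \<and>
       X = (\<Sum>i<p. s i *\<^sub>R outer_prod (u i) (v i)))"

text \<open>A relation rather than a function: if the \<open>r\<close>-th and \<open>r+1\<close>-st singular values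
  coincide, the truncation depends on the choice of the singular vectors.\<close>

definition truncated_svd :: "nat \<Rightarrow> real^'d^'n \<Rightarrow> real^'d^'n \<Rightarrow> bool" where
  "truncated_svd r X T \<longleftrightarrow>
     (\<exists>u s v. is_svd X u s v \<and> T = (\<Sum>i<r. s i *\<^sub>R outer_prod (u i) (v i)))"

text \<open>In the next two definitions \<open>R\<close> is a random matrix on the probability space \<open>M\<close>.
  The points are given as a family, so repetitions are allowed; since a smaller set of points
  can always be enlarged, this is the same as asking for \<open>m\<close> distinct points.\<close>

definition JLT :: "'w measure \<Rightarrow> ('w \<Rightarrow> real^'k^'d) \<Rightarrow> nat \<Rightarrow> real \<Rightarrow> real \<Rightarrow> bool" where
  "JLT M R m \<epsilon> \<delta> \<longleftrightarrow> 0 < \<epsilon> \<and> \<epsilon> < 1 \<and> 0 < \<delta> \<and> \<delta> < 1 \<and>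
     (\<forall>v :: nat \<Rightarrow> real^'d.
        measure M {\<omega> \<in> space M. \<forall>i<m.
          (1 - \<epsilon>) * (norm (v i))\<^sup>2 \<le> (norm (transpose (R \<omega>) *v v i))\<^sup>2 \<and>
          (norm (transpose (R \<omega>) *v v i))\<^sup>2 \<le> (1 + \<epsilon>) * (norm (v i))\<^sup>2} \<ge> 1 - \<delta>)"

definition restricted_isometry ::
  "'w measure \<Rightarrow> ('w \<Rightarrow> real^'k^'d) \<Rightarrow> nat \<Rightarrow> real \<Rightarrow> real \<Rightarrow> bool" where
  "restricted_isometry M R s \<epsilon> \<delta> \<longleftrightarrow> 0 < \<epsilon> \<and> \<epsilon> < 1 \<and> 0 < \<delta> \<and> \<delta> < 1 \<and>
     (\<forall>V :: (real^'d) set. subspace V \<longrightarrow> dim V = s \<longrightarrow>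
        measure M {\<omega> \<in> space M. \<forall>v\<in>V.
          (1 - \<epsilon>) * norm v \<le> norm (transpose (R \<omega>) *v v) \<and>
          norm (transpose (R \<omega>) *v v) \<le> (1 + \<epsilon>) * norm v} \<ge> 1 - \<delta>)"

definition uncorrelated_noise :: "'w measure \<Rightarrow> ('w \<Rightarrow> real^'n) \<Rightarrow> real \<Rightarrow> bool" where
  "uncorrelated_noise M \<xi> \<sigma> \<longleftrightarrow>
     \<xi> \<in> borel_measurable M \<and>
     (\<forall>i. integrable M (\<lambda>\<omega>. (\<xi> \<omega> $ i)\<^sup>2)) \<and>
     (\<forall>i. prob_space.expectation M (\<lambda>\<omega>. \<xi> \<omega> $ i) = 0) \<and>
     (\<forall>i. prob_space.variance M (\<lambda>\<omega>. \<xi> \<omega> $ i) = \<sigma>\<^sup>2) \<and>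
     (\<forall>i j. i \<noteq> j \<longrightarrow> prob_space.expectation M
        (\<lambda>\<omega>. (\<xi> \<omega> $ i - prob_space.expectation M (\<lambda>\<omega>. \<xi> \<omega> $ i)) *
             (\<xi> \<omega> $ j - prob_space.expectation M (\<lambda>\<omega>. \<xi> \<omega> $ j))) = 0)"

definition min_norm_solution :: "real^'d^'n \<Rightarrow> real^'n \<Rightarrow> real^'d \<Rightarrow> bool" where
  "min_norm_solution X f w \<longleftrightarrow> is_arg_min norm (\<lambda>w. X *v w = proj_mat X *v f) w"

definition least_squares_solution :: "real^'k^'n \<Rightarrow> real^'n \<Rightarrow> real^'k \<Rightarrow> bool" where
  "least_squares_solution A y w \<longleftrightarrow> A *v w = proj_mat A *v y"

text \<open>In the following, \<open>S\<close> is a fixed matrix, and \<open>what S y\<close> is the least squares estimator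
  for the design \<open>X ** S\<close> and the response \<open>y\<close>; the expectation is over the noise only.\<close>

definition excess_risk ::
  "'w measure \<Rightarrow> real^'d^'n \<Rightarrow> real^'n \<Rightarrow> ('w \<Rightarrow> real^'n) \<Rightarrow> real^'d \<Rightarrow>
   (real^'k^'d \<Rightarrow> real^'n \<Rightarrow> real^'k) \<Rightarrow> real^'k^'d \<Rightarrow> real" where
  "excess_risk M X f \<xi> wstar what S =
     prob_space.expectation M (\<lambda>\<omega>.
       (norm (X *v wstar - (X ** S) *v what S (f + \<xi> \<omega>)))\<^sup>2 / real CARD('n))"

end

theory Submission
  imports Defs
begin

text \<open>Let \<open>V\<close> be the span of the first \<open>r\<close> right singular vectors \<open>v j\<close> of \<open>X\<close>, so that each row
  of \<open>X\<close> is \<open>t + z\<close> with \<open>t\<close> in \<open>V\<close> and \<open>z\<close>, a row of \<open>X - T\<close>, orthogonal to \<open>V\<close>. For every \<open>B\<close>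
  the residual of projecting \<open>X\<close> onto the columns of \<open>X ** S\<close> is at most \<open>norm (X - X ** S ** B)\<close>.
  Take for \<open>transpose B\<close> the map that sends \<open>y\<close> to the element of \<open>V\<close> whose sketch is closest to \<open>y\<close>.
  Then the row error is \<open>z - c\<close>, where \<open>c\<close> in \<open>V\<close> comes from the sketch of \<open>z\<close>, and its squared norm
  is that of \<open>z\<close> plus that of \<open>c\<close>. The sketch of \<open>c\<close> is a projection of the sketch of \<open>z\<close>, hence
  the restricted isometry bounds \<open>(1 - \<epsilon>2)\<^sup>2 * (norm c)\<^sup>2\<close> by the inner product of the sketches of \<open>z\<close>
  and \<open>c\<close>, which is small: polarisation turns the norm bounds for the \<open>2nr\<close> points
  \<open>sgn z + v j\<close> and \<open>sgn z - v j\<close> into a bound for the sketched inner products of \<open>z\<close> and \<open>v j\<close>.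
  The excess risk splits orthogonally into the bias, controlled by this residual, and the
  variance \<open>\<sigma>\<^sup>2\<close> times the squared norm of a projection of rank at most \<open>k\<close>.\<close>

section \<open>Matrices and the Frobenius norm\<close>

lemma norm_matrix_rows:
  fixes A :: "real^'m^'n"
  shows "(norm A)\<^sup>2 = (\<Sum>i\<in>UNIV. (norm (A $ i))\<^sup>2)"
  by (simp add: power2_norm_eq_inner inner_vec_def)

lemma norm_transpose:
  fixes A :: "real^'m^'n"
  shows "norm (transpose A) = norm A"
  unfolding norm_matrix_Frobenius transpose_def by (subst sum.swap) simp

lemma norm_matrix_columns:
  fixes A :: "real^'m^'n"
  shows "(norm A)\<^sup>2 = (\<Sum>j\<in>UNIV. (norm (column j A))\<^sup>2)"
proof -
  have "(norm A)\<^sup>2 = (norm (transpose A))\<^sup>2" by (simp add: norm_transpose)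
  also have "\<dots> = (\<Sum>j\<in>UNIV. (norm (column j A))\<^sup>2)"
    unfolding norm_matrix_rows by (simp add: transpose_def column_def)
  finally show ?thesis .
qed

lemma column_matrix_mult:
  fixes A :: "real^'m^'n" and B :: "real^'p^'m"
  shows "column j (A ** B) = A *v column j B"
  by (simp add: column_def matrix_matrix_mult_def matrix_vector_mult_def vec_eq_iff)

lemma row_matrix_mult_transpose:
  fixes A :: "real^'m^'n" and B :: "real^'m^'p"
  shows "(A ** transpose B) $ i = B *v (A $ i)"
  by (simp add: matrix_matrix_mult_def matrix_vector_mult_def transpose_def vec_eq_iff mult.commute)

text \<open>Cauchy-Schwarz in each row. With \<open>x = wstar\<close> it turns the residual bound
  into a bound on the bias.\<close>

lemma norm_matrix_vector_le_Frobenius: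
  fixes A :: "real^'m^'n"
  shows "(norm (A *v x))\<^sup>2 \<le> (norm A)\<^sup>2 * (norm x)\<^sup>2"
proof -
  have "(norm (A *v x))\<^sup>2 = (\<Sum>i\<in>UNIV. (A $ i \<bullet> x)\<^sup>2)"
    unfolding power2_norm_eq_inner inner_vec_def[of "A *v x"]
    by (simp add: matrix_vector_mul_component power2_eq_square)
  also have "\<dots> \<le> (\<Sum>i\<in>UNIV. (norm (A $ i))\<^sup>2 * (norm x)\<^sup>2)"
    by (intro sum_mono) (metis Cauchy_Schwarz_ineq power2_norm_eq_inner)
  finally show ?thesis by (simp add: norm_matrix_rows sum_distrib_right)
qed

lemma in_span_columns_iff:
  fixes A :: "real^'m^'n"
  shows "x \<in> span (columns A) \<longleftrightarrow> (\<exists>w. x = A *v w)"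
proof
  assume x: "x \<in> span (columns A)"
  have "subspace (range (\<lambda>w. A *v w))"
    by (intro linear_subspace_image) auto
  moreover have "columns A \<subseteq> range (\<lambda>w. A *v w)"
    by (auto simp: columns_def matrix_vector_mult_basis[symmetric])
  ultimately show "\<exists>w. x = A *v w" using x span_minimal by blast
qed (auto simp: matrix_vector_mult_in_columnspace)

lemma span_columns_mult:
  fixes A :: "real^'m^'n" and B :: "real^'p^'m"
  shows "span (columns (A ** B)) \<subseteq> span (columns A)"
  by (auto simp: in_span_columns_iff matrix_vector_mul_assoc[symmetric])

section \<open>Orthogonal projections onto column spaces\<close>

lemma proj_mat_eqI:
  fixes A :: "real^'m^'n"
  assumes "p \<in> span (columns A)" "\<And>z. z \<in> span (columns A) \<Longrightarrow> orthogonal (x - p) z"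
  shows "proj_mat A *v x = p"
  using ex1_orthogonal_projection[of "columns A" x] proj_mat(1)[of A x] proj_mat(2)[of _ A x]
    assms by blast

text \<open>Pythagoras: the residual is orthogonal to the column space, which contains
  \<open>proj_mat A *v x - A *v w\<close>.\<close>

lemma norm_proj_mat_residual_le:
  fixes A :: "real^'m^'n"
  shows "norm (x - proj_mat A *v x) \<le> norm (x - A *v w)"
proof -
  let ?p = "proj_mat A *v x"
  have "?p - A *v w \<in> span (columns A)"
    by (simp add: matrix_vector_mult_in_columnspace proj_mat(1) span_diff)
  then have "orthogonal (x - ?p) (?p - A *v w)" by (rule proj_mat(2))
  then have "(norm ((x - ?p) + (?p - A *v w)))\<^sup>2 = (norm (x - ?p))\<^sup>2 + (norm (?p - A *v w))\<^sup>2"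
    by (rule norm_add_Pythagorean)
  then have "(norm (x - ?p))\<^sup>2 \<le> (norm (x - A *v w))\<^sup>2" by simp
  then show ?thesis by (rule power2_le_imp_le) simp
qed

lemma column_residual:
  fixes A :: "real^'m^'n" and X :: "real^'d^'n"
  shows "column j ((mat 1 - proj_mat A) ** X) = column j X - proj_mat A *v column j X"
  by (simp add: column_matrix_mult matrix_vector_mult_diff_rdistrib)

text \<open>The squared Frobenius norm is a sum over columns, and projecting minimises the error in
  each one. Hence any convenient \<open>B\<close> gives an upper bound.\<close>

lemma norm_residual_le:
  fixes A :: "real^'m^'n" and X :: "real^'d^'n"
  shows "norm ((mat 1 - proj_mat A) ** X) \<le> norm (X - A ** B)"
proof -
  have "(norm ((mat 1 - proj_mat A) ** X))\<^sup>2 \<le> (norm (X - A ** B))\<^sup>2"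
    unfolding norm_matrix_columns
  proof (intro sum_mono power_mono)
    fix j
    have "column j (X - A ** B) = column j X - A *v column j B"
      by (simp add: column_matrix_mult[symmetric]) (simp add: column_def vec_eq_iff)
    then show "norm (column j ((mat 1 - proj_mat A) ** X)) \<le> norm (column j (X - A ** B))"
      by (simp add: column_residual norm_proj_mat_residual_le)
  qed simp
  then show ?thesis by (rule power2_le_imp_le) simp
qed

text \<open>Projected columns are images under \<open>A\<close>; their coefficient vectors form the
  columns of \<open>B\<close>. With the previous bound, the residual norm is a minimum over
  \<open>B\<close>.\<close>

lemma residual_attained:
  fixes A :: "real^'m^'n" and X :: "real^'d^'n"
  obtains B where "(mat 1 - proj_mat A) ** X = X - A ** B"
proof -
  have "\<exists>w. proj_mat A *v column j X = A *v w" for j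
    using proj_mat(1) in_span_columns_iff by blast
  then obtain w where w: "\<And>j. proj_mat A *v column j X = A *v w j" by metis
  define B where "B = (\<chi> i j. w j $ i)"
  have colB: "column j B = w j" for j by (simp add: B_def column_def)
  have "column j ((mat 1 - proj_mat A) ** X) = column j X - column j (A ** B)" for j
    by (simp only: column_residual w column_matrix_mult[of _ A B] colB)
  then have "(mat 1 - proj_mat A) ** X = X - A ** B" by (simp add: column_def vec_eq_iff)
  then show ?thesis by (rule that)
qed

text \<open>The residual norm is the infimum over \<open>B\<close> of a continuous function of \<open>S\<close>, so its strict
  sublevel sets are open.\<close>

lemma borel_measurable_residual [measurable]:
  fixes X :: "real^'d^'n"
  shows "(\<lambda>S :: real^'k^'d. norm ((mat 1 - proj_mat (X ** S)) ** X)) \<in> borel_measurable borel"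
proof (rule borel_measurableI_less)
  fix c :: real
  let ?h = "\<lambda>S :: real^'k^'d. norm ((mat 1 - proj_mat (X ** S)) ** X)"
  have "{S. ?h S < c} = (\<Union>B. {S :: real^'k^'d. norm (X - X ** S ** B) < c})" (is "_ = (\<Union>B. ?U B)")
  proof safe
    fix S :: "real^'k^'d" assume "?h S < c"
    moreover obtain B where "(mat 1 - proj_mat (X ** S)) ** X = X - X ** S ** B"
      by (rule residual_attained)
    ultimately show "S \<in> (\<Union>B. ?U B)" by (intro UN_I[of B]) auto
  next
    fix S :: "real^'k^'d" and B assume "norm (X - X ** S ** B) < c"
    then show "?h S < c" using norm_residual_le[of "X ** S" X B] by linarith
  qed
  moreover have "open (?U B)" for B
    by (intro open_Collect_less continuous_intros)
      (auto simp: matrix_matrix_mult_def intro!: continuous_intros)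
  ultimately show "{S \<in> space borel. ?h S < c} \<in> sets borel"
    by (simp add: borel_open open_UN)
qed

text \<open>The squared Frobenius norm of an orthogonal projection is its rank, as an orthonormal
  basis \<open>B\<close> of the column space shows; the rank is at most the number of
  columns.\<close>

lemma norm_proj_mat_le:
  fixes A :: "real^'k^'n"
  shows "(norm (proj_mat A))\<^sup>2 \<le> real CARD('k)"
proof -
  obtain B where B: "pairwise orthogonal B" "\<And>x. x \<in> B \<Longrightarrow> norm x = 1"
      "independent B" "card B = dim (span (columns A))" "span B = span (columns A)"
    using orthonormal_basis_subspace[OF subspace_span] by metis
  have fin: "finite B" using B(3) independent_bound by auto
  have col: "(norm (column a (proj_mat A)))\<^sup>2 = (\<Sum>b\<in>B. (b $ a)\<^sup>2)" for a
  proof -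
    let ?e = "axis a 1 :: real^'n"
    let ?p = "proj_mat A *v ?e"
    \<comment> \<open>\<open>axis a 1\<close> and its projection differ by a vector orthogonal to
      \<open>b\<close>.\<close>
    have pb: "?p \<bullet> b = b $ a" if "b \<in> B" for b
    proof -
      have "orthogonal (?e - ?p) b"
        using proj_mat(2)[of b A ?e] B(5) that span_base by blast
      then show ?thesis by (simp add: orthogonal_def inner_diff_left inner_axis')
    qed
    have "?p \<bullet> ?p = ?p \<bullet> (\<Sum>b\<in>B. (?p \<bullet> b) *\<^sub>R b)"
      using orthonormal_basis_expand[OF B(1,2) _ fin, of ?p] proj_mat(1)[of A ?e] B(5) by simp
    also have "\<dots> = (\<Sum>b\<in>B. (b $ a)\<^sup>2)"
      by (simp add: inner_sum_right power2_eq_square pb)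
    finally show ?thesis
      by (simp add: power2_norm_eq_inner matrix_vector_mult_basis)
  qed
  have "(norm (proj_mat A))\<^sup>2 = (\<Sum>b\<in>B. \<Sum>a\<in>UNIV. (b $ a)\<^sup>2)"
    unfolding norm_matrix_columns col by (rule sum.swap)
  also have "\<dots> = (\<Sum>b\<in>B. (norm b)\<^sup>2)"
    by (simp add: norm_vec_def L2_set_def sum_nonneg)
  also have "\<dots> = real (dim (columns A))" by (simp add: B(2,4))
  also have "dim (columns A) \<le> CARD('k)"
  proof -
    have *: "columns A = (\<lambda>j. column j A) ` UNIV" by (auto simp: columns_def)
    then have "finite (columns A)" by simp
    then have "dim (columns A) \<le> card (columns A)" by (rule dim_le_card')
    also have "\<dots> \<le> CARD('k)" unfolding * by (rule card_image_le) simp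
    finally show ?thesis .
  qed
  finally show ?thesis by simp
qed

section \<open>Sketches preserving a subspace\<close>

text \<open>Least squares within \<open>V\<close>: \<open>L\<close> projects \<open>y\<close> onto
  the sketch of \<open>V\<close> and then inverts the sketch, which is injective on \<open>V\<close>
  by the lower bound.\<close>

lemma sketch_left_inverse:
  fixes S :: "real^'k^'d" and V :: "(real^'d) set"
  assumes V: "subspace V" and "0 < a"
    and lower: "\<And>v. v \<in> V \<Longrightarrow> a * norm v \<le> norm (transpose S *v v)"
  obtains L :: "real^'k^'d" where "\<And>y. L *v y \<in> V"
    "\<And>v. v \<in> V \<Longrightarrow> L *v (transpose S *v v) = v"
    "\<And>y v. v \<in> V \<Longrightarrow> (y - transpose S *v (L *v y)) \<bullet> (transpose S *v v) = 0"
proof -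
  let ?f = "\<lambda>v. transpose S *v v"
  have inj: "inj_on ?f V"
  proof (rule inj_onI)
    fix x y assume xy: "x \<in> V" "y \<in> V" "?f x = ?f y"
    then have "a * norm (x - y) \<le> norm (?f (x - y))" by (intro lower subspace_diff V)
    then have "a * norm (x - y) \<le> 0" using xy(3) by (simp add: matrix_vector_mult_diff_distrib)
    then show "x = y" using \<open>0 < a\<close> by (simp add: mult_le_0_iff)
  qed
  obtain g where g: "range g \<subseteq> V" "linear g" "\<And>v. v \<in> V \<Longrightarrow> g (?f v) = v"
    using linear_exists_left_inverse_on[OF matrix_vector_mul_linear V inj] by blast
  \<comment> \<open>\<open>h\<close> is a linear retraction onto \<open>V\<close>. It presents the
    sketch of \<open>V\<close> as the column space of a matrix, so that \<open>proj_mat\<close>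
    applies.\<close>
  obtain h :: "real^'d \<Rightarrow> real^'d" where h: "range h \<subseteq> V" "linear h" "\<And>v. v \<in> V \<Longrightarrow> h v = v"
    using linear_exists_left_inverse_on[OF linear_ident V inj_on_id2] by blast
  define A where "A = transpose S ** matrix h"
  have Aw: "A *v w = ?f (h w)" for w
    by (simp add: A_def matrix_vector_mul_assoc[symmetric] matrix_works h(2))
  have sp: "span (columns A) = ?f ` V"
  proof (intro set_eqI iffI)
    fix y assume "y \<in> span (columns A)"
    then show "y \<in> ?f ` V" using h(1) unfolding in_span_columns_iff Aw by blast
  next
    fix y assume "y \<in> ?f ` V"
    then obtain x where "x \<in> V" "y = ?f x" by blast
    then have "y = A *v x" by (simp only: Aw h(3))
    then show "y \<in> span (columns A)" unfolding in_span_columns_iff by blast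
  qed
  define L where "L = matrix g ** proj_mat A"
  have Ly: "L *v y = g (proj_mat A *v y)" for y
    by (simp add: L_def matrix_vector_mul_assoc[symmetric] matrix_works g(2))
  have fL: "?f (L *v y) = proj_mat A *v y" for y
    using proj_mat(1)[of A y] g(3) by (auto simp: Ly sp)
  show ?thesis
  proof
    show "L *v y \<in> V" for y using g(1) by (auto simp: Ly)
    show "L *v (?f v) = v" if "v \<in> V" for v
    proof -
      have "proj_mat A *v ?f v = ?f v"
        using that by (intro proj_mat_eqI) (auto simp: sp orthogonal_def)
      then show ?thesis by (simp only: Ly g(3)[OF that])
    qed
    show "(y - ?f (L *v y)) \<bullet> ?f v = 0" if "v \<in> V" for y v
    proof -
      have "?f v \<in> span (columns A)" unfolding sp using that by (rule imageI)
      then show ?thesis unfolding fL by (rule proj_mat(2)[unfolded orthogonal_def])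
    qed
  qed
qed

text \<open>Deterministic core, later used with \<open>\<beta> = 1 - \<epsilon>2\<close> and
  \<open>\<epsilon> = \<epsilon>1 / sqrt (real r)\<close>. The lower bound enters as
  \<open>\<beta>\<^sup>2\<close> and is squared for Cauchy-Schwarz, which produces
  \<open>\<beta> ^ 4\<close>.\<close>

lemma sketch_residual_le:
  fixes S :: "real^'k^'d" and X T :: "real^'d^'n" and v :: "nat \<Rightarrow> real^'d"
  assumes orth: "\<And>i j. i < r \<Longrightarrow> j < r \<Longrightarrow> v i \<bullet> v j = (if i = j then 1 else 0)"
    and T: "\<And>a. T $ a \<in> span (v ` {..<r})"
    and XT: "\<And>a j. j < r \<Longrightarrow> (X - T) $ a \<bullet> v j = 0"
    and "0 < \<beta>" "0 \<le> \<epsilon>"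
    and lower: "\<And>x. x \<in> span (v ` {..<r}) \<Longrightarrow> \<beta> * norm x \<le> norm (transpose S *v x)"
    and cross: "\<And>a j. j < r \<Longrightarrow>
      \<bar>(transpose S *v ((X - T) $ a)) \<bullet> (transpose S *v v j)\<bar> \<le> \<epsilon> * norm ((X - T) $ a)"
  shows "(norm ((mat 1 - proj_mat (X ** S)) ** X))\<^sup>2
           \<le> (1 + real r * \<epsilon>\<^sup>2 / \<beta> ^ 4) * (norm (X - T))\<^sup>2"
proof -
  define V where "V = span (v ` {..<r})"
  let ?f = "\<lambda>x. transpose S *v x"
  obtain L where L: "\<And>y. L *v y \<in> V" "\<And>v. v \<in> V \<Longrightarrow> L *v ?f v = v"
    "\<And>y v. v \<in> V \<Longrightarrow> (y - ?f (L *v y)) \<bullet> ?f v = 0"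
    using sketch_left_inverse[of V \<beta> S] lower \<open>0 < \<beta>\<close> unfolding V_def by (metis subspace_span)
  have inj: "inj_on v {..<r}"
    by (rule inj_onI) (metis lessThan_iff orth zero_neq_one)
  have pw: "pairwise orthogonal (v ` {..<r})"
    by (auto simp: pairwise_def orthogonal_def orth)
  have n1: "norm x = 1" if "x \<in> v ` {..<r}" for x
    using that orth by (auto simp: norm_eq_sqrt_inner)
  have expand: "x = (\<Sum>j<r. (x \<bullet> v j) *\<^sub>R v j)" if "x \<in> V" for x
    using orthonormal_basis_expand[OF pw n1, of x] that
    by (simp add: V_def sum.reindex[OF inj])
  have row: "(norm ((X - X ** S ** transpose L) $ a))\<^sup>2
      \<le> (1 + real r * \<epsilon>\<^sup>2 / \<beta> ^ 4) * (norm ((X - T) $ a))\<^sup>2" for a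
  proof -
    define z where "z = (X - T) $ a"
    define c where "c = L *v ?f z"
    have cV: "c \<in> V" by (simp add: c_def L)
    have Xa: "X $ a = T $ a + z" by (simp add: z_def)
    have "(X ** S) $ a = ?f (X $ a)"
      by (metis row_matrix_mult_transpose transpose_transpose)
    then have "(X ** S ** transpose L) $ a = L *v ?f (T $ a + z)"
      by (simp add: row_matrix_mult_transpose Xa)
    \<comment> \<open>\<open>L\<close> undoes the sketch on \<open>T $ a\<close>, which lies in
      \<open>V\<close>.\<close>
    also have "\<dots> = T $ a + c"
      using T L(2) by (simp add: c_def matrix_vector_right_distrib V_def)
    finally have eq: "(X - X ** S ** transpose L) $ a = z - c" by (simp add: Xa)
    have zc: "z \<bullet> c = 0"
      by (subst expand[OF cV]) (simp add: inner_sum_right z_def XT del: vector_minus_component)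
    have "(\<beta> * norm c)\<^sup>2 \<le> (norm (?f c))\<^sup>2"
      using lower[of c] cV \<open>0 < \<beta>\<close> by (intro power_mono) (auto simp: V_def)
    \<comment> \<open>By the choice of \<open>L\<close>, the sketches of \<open>z - c\<close> and
      \<open>c\<close> are orthogonal.\<close>
    also have "\<dots> = ?f z \<bullet> ?f c"
      using L(3)[OF cV, of "?f z"] by (simp add: c_def power2_norm_eq_inner inner_diff_left)
    also have "?f c = (\<Sum>j<r. (c \<bullet> v j) *\<^sub>R ?f (v j))"
      by (subst expand[OF cV]) (simp only: linear_sum[OF matrix_vector_mul_linear] matrix_vector_mult_scaleR)
    also have "?f z \<bullet> \<dots> = (\<Sum>j<r. (c \<bullet> v j) * (?f z \<bullet> ?f (v j)))"
      by (simp add: inner_sum_right)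
    finally have 1: "(\<beta> * norm c)\<^sup>2 \<le> (\<Sum>j<r. (c \<bullet> v j) * (?f z \<bullet> ?f (v j)))" .
    \<comment> \<open>Both sides are squared so that Cauchy-Schwarz separates the coordinates of
      \<open>c\<close> from the cross terms; the squares of the former sum to
      \<open>(norm c)\<^sup>2\<close>, which cancels afterwards.\<close>
    have "((\<beta> * norm c)\<^sup>2)\<^sup>2 \<le> (\<Sum>j<r. (c \<bullet> v j) * (?f z \<bullet> ?f (v j)))\<^sup>2"
      using 1 by (intro power_mono) auto
    also have "\<dots> \<le> (\<Sum>j<r. (c \<bullet> v j)\<^sup>2) * (\<Sum>j<r. (?f z \<bullet> ?f (v j))\<^sup>2)"
      by (rule Cauchy_Schwarz_ineq_sum)
    also have "(\<Sum>j<r. (c \<bullet> v j)\<^sup>2) = (norm c)\<^sup>2"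
    proof -
      have "c \<bullet> c = c \<bullet> (\<Sum>j<r. (c \<bullet> v j) *\<^sub>R v j)" using expand[OF cV] by simp
      then show ?thesis
        by (simp add: inner_sum_right power2_norm_eq_inner power2_eq_square[of "_ \<bullet> _"])
    qed
    also have "(norm c)\<^sup>2 * (\<Sum>j<r. (?f z \<bullet> ?f (v j))\<^sup>2) \<le> (norm c)\<^sup>2 * (\<Sum>j<r. (\<epsilon> * norm z)\<^sup>2)"
    proof (intro mult_left_mono sum_mono)
      fix j assume "j \<in> {..<r}"
      then have "\<bar>?f z \<bullet> ?f (v j)\<bar> \<le> \<epsilon> * norm z"
        unfolding z_def by (intro cross) simp
      then show "(?f z \<bullet> ?f (v j))\<^sup>2 \<le> (\<epsilon> * norm z)\<^sup>2"
        by (rule power2_le_iff_abs_le[THEN iffD2, rotated]) (use \<open>0 \<le> \<epsilon>\<close> in simp)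
    qed simp
    also have "((\<beta> * norm c)\<^sup>2)\<^sup>2 = (norm c)\<^sup>2 * (\<beta> ^ 4 * (norm c)\<^sup>2)"
      by (simp add: power4_eq_xxxx power2_eq_square)
    finally have "(norm c)\<^sup>2 * (\<beta> ^ 4 * (norm c)\<^sup>2) \<le> (norm c)\<^sup>2 * (real r * \<epsilon>\<^sup>2 * (norm z)\<^sup>2)"
      by (simp add: power_mult_distrib)
    then have "\<beta> ^ 4 * (norm c)\<^sup>2 \<le> real r * \<epsilon>\<^sup>2 * (norm z)\<^sup>2"
      by (cases "c = 0") (simp_all add: mult_le_cancel_left)
    then have "(norm c)\<^sup>2 \<le> real r * \<epsilon>\<^sup>2 / \<beta> ^ 4 * (norm z)\<^sup>2"
      using \<open>0 < \<beta>\<close> by (simp add: field_simps)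
    moreover have "(norm (z - c))\<^sup>2 = (norm z)\<^sup>2 + (norm c)\<^sup>2"
      using zc by (simp add: power2_norm_eq_inner inner_diff_left inner_diff_right inner_commute)
    ultimately have "(norm (z - c))\<^sup>2 \<le> (1 + real r * \<epsilon>\<^sup>2 / \<beta> ^ 4) * (norm z)\<^sup>2"
      by (simp add: distrib_right)
    then show ?thesis by (simp only: eq z_def)
  qed
  have "(norm ((mat 1 - proj_mat (X ** S)) ** X))\<^sup>2 \<le> (norm (X - X ** S ** transpose L))\<^sup>2"
    by (intro power_mono norm_residual_le) simp
  also have "\<dots> \<le> (1 + real r * \<epsilon>\<^sup>2 / \<beta> ^ 4) * (norm (X - T))\<^sup>2"
    unfolding norm_matrix_rows sum_distrib_left by (intro sum_mono row)
  finally show ?thesis .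
qed

text \<open>Polarisation. For \<open>z \<noteq> 0\<close>, normalising gives
  \<open>sgn z + v\<close> and \<open>sgn z - v\<close> the same squared norm \<open>2\<close>, so
  their sketched squared norms differ by at most \<open>4 * \<epsilon>\<close>; rescaling by
  \<open>norm z\<close> restores \<open>z\<close>.\<close>

lemma JLT_cross_bound:
  fixes S :: "real^'k^'d"
  assumes "norm v = 1" "z \<bullet> v = 0"
    and upper: "(norm (transpose S *v (sgn z + v)))\<^sup>2 \<le> (1 + \<epsilon>) * (norm (sgn z + v))\<^sup>2"
      "(norm (transpose S *v (sgn z - v)))\<^sup>2 \<le> (1 + \<epsilon>) * (norm (sgn z - v))\<^sup>2"
    and lower: "(1 - \<epsilon>) * (norm (sgn z + v))\<^sup>2 \<le> (norm (transpose S *v (sgn z + v)))\<^sup>2"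
      "(1 - \<epsilon>) * (norm (sgn z - v))\<^sup>2 \<le> (norm (transpose S *v (sgn z - v)))\<^sup>2"
  shows "\<bar>(transpose S *v z) \<bullet> (transpose S *v v)\<bar> \<le> \<epsilon> * norm z"
proof (cases "z = 0")
  case False
  let ?f = "\<lambda>x. transpose S *v x"
  have sv: "sgn z \<bullet> v = 0" "norm (sgn z) = 1"
    using assms(2) False by (simp_all add: sgn_div_norm)
  then have n: "(norm (sgn z + v))\<^sup>2 = 2" "(norm (sgn z - v))\<^sup>2 = 2"
    using assms(1) unfolding power2_norm_eq_inner norm_eq_sqrt_inner
    by (simp_all add: algebra_simps inner_commute)
  have "4 * (?f (sgn z) \<bullet> ?f v) = (norm (?f (sgn z + v)))\<^sup>2 - (norm (?f (sgn z - v)))\<^sup>2"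
    by (simp add: power2_norm_eq_inner matrix_vector_right_distrib
        matrix_vector_mult_diff_distrib algebra_simps inner_commute)
  then have "\<bar>?f (sgn z) \<bullet> ?f v\<bar> \<le> \<epsilon>"
    using upper lower unfolding n by (simp add: abs_le_iff algebra_simps)
  then have "norm z * \<bar>?f (sgn z) \<bullet> ?f v\<bar> \<le> norm z * \<epsilon>" by (intro mult_left_mono) auto
  moreover have "?f z = norm z *\<^sub>R ?f (sgn z)"
    unfolding matrix_vector_mult_scaleR[symmetric] using False by (simp add: sgn_div_norm)
  ultimately show ?thesis by (simp add: abs_mult mult.commute)
qed simp

section \<open>Singular vectors and the union bound\<close>

text \<open>Row \<open>a\<close> of \<open>outer_prod (u i) (v i)\<close> is a multiple of
  \<open>v i\<close>. So the rows of \<open>T\<close> combine the first \<open>r\<close> vectors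
  \<open>v i\<close>, and those of \<open>X - T\<close> only the later ones.\<close>

lemma truncated_svd_right_vectors:
  fixes X T :: "real^'d^'n"
  assumes "truncated_svd r X T" and r: "r \<le> min CARD('d) CARD('n)"
  obtains v where "\<And>i j. i < r \<Longrightarrow> j < r \<Longrightarrow> v i \<bullet> v j = (if i = j then 1 else 0)"
    "\<And>a. T $ a \<in> span (v ` {..<r})"
    "\<And>a j. j < r \<Longrightarrow> (X - T) $ a \<bullet> v j = 0"
proof -
  define p where "p = min CARD('d) CARD('n)"
  obtain u s v where svd: "is_svd X u s v" and T: "T = (\<Sum>i<r. s i *\<^sub>R outer_prod (u i) (v i))"
    using assms(1) unfolding truncated_svd_def by blast
  have orth: "v i \<bullet> v j = (if i = j then 1 else 0)" if "i < p" "j < p" for i j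
    using svd that unfolding is_svd_def Let_def p_def[symmetric] by blast
  have X: "X = (\<Sum>i<p. s i *\<^sub>R outer_prod (u i) (v i))"
    using svd unfolding is_svd_def Let_def p_def[symmetric] by blast
  have rp: "r \<le> p" using r by (simp add: p_def)
  have row: "(\<Sum>i\<in>I. s i *\<^sub>R outer_prod (u i) (v i)) $ a = (\<Sum>i\<in>I. (s i * u i $ a) *\<^sub>R v i)"
    for I a by (simp add: vec_eq_iff outer_prod_def mult.assoc)
  have "X = T + (\<Sum>i\<in>{r..<p}. s i *\<^sub>R outer_prod (u i) (v i))"
    unfolding X T using rp by (simp add: lessThan_atLeast0 sum.atLeastLessThan_concat)
  then have XT: "X - T = (\<Sum>i\<in>{r..<p}. s i *\<^sub>R outer_prod (u i) (v i))" by simp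
  show ?thesis
  proof
    show "v i \<bullet> v j = (if i = j then 1 else 0)" if "i < r" "j < r" for i j
      using orth that rp by simp
    show "T $ a \<in> span (v ` {..<r})" for a
      unfolding T row by (intro span_sum span_scale span_base) auto
    show "(X - T) $ a \<bullet> v j = 0" if "j < r" for a j
      unfolding XT row inner_sum_left using that rp by (intro sum.neutral) (auto simp: orth)
  qed
qed

text \<open>Makes the span of the \<open>v i\<close> an admissible subspace in
  \<open>restricted_isometry\<close> with \<open>s = r\<close>.\<close>

lemma dim_span_orthonormal:
  fixes v :: "nat \<Rightarrow> 'a::euclidean_space"
  assumes orth: "\<And>i j. i < r \<Longrightarrow> j < r \<Longrightarrow> v i \<bullet> v j = (if i = j then 1 else 0)"
  shows "dim (span (v ` {..<r})) = r"
proof -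
  have inj: "inj_on v {..<r}"
    by (rule inj_onI) (metis lessThan_iff orth zero_neq_one)
  have "pairwise orthogonal (v ` {..<r})"
    by (auto simp: pairwise_def orthogonal_def orth)
  moreover have "0 \<notin> v ` {..<r}"
    using orth by (metis imageE inner_zero_left lessThan_iff zero_neq_one)
  ultimately have "independent (v ` {..<r})" by (rule pairwise_orthogonal_independent)
  then show ?thesis by (simp add: dim_eq_card_independent card_image[OF inj])
qed

text \<open>A union bound on the complements. As in \<open>JLT\<close> and
  \<open>restricted_isometry\<close>, \<open>A\<close> and \<open>B\<close> are not assumed
  measurable; \<open>\<delta>\<close> and \<open>\<delta>'\<close> below \<open>1\<close> make their
  probabilities positive, which forces it.\<close>

lemma (in prob_space) prob_Int_ge:
  assumes "1 - \<delta> \<le> prob A" "1 - \<delta>' \<le> prob B" "\<delta> < 1" "\<delta>' < 1"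
    and C: "C \<in> events" "A \<inter> B \<subseteq> C"
  shows "1 - \<delta> - \<delta>' \<le> prob C"
proof -
  \<comment> \<open>The measure of a non-measurable set is \<open>0\<close>.\<close>
  have meas: "A \<in> events" "B \<in> events"
    using assms measure_notin_sets[of A M] measure_notin_sets[of B M] by force+
  have "prob (space M - C) \<le> prob ((space M - A) \<union> (space M - B))"
    using meas C by (intro finite_measure_mono) auto
  also have "\<dots> \<le> prob (space M - A) + prob (space M - B)"
    using meas by (intro measure_Un_le) auto
  finally show ?thesis using assms meas by (simp add: prob_compl)
qed

section \<open>The excess risk\<close>

text \<open>The covariance matrix is \<open>\<sigma>\<^sup>2\<close> times the identity, so
  expanding the square leaves only diagonal terms in expectation.\<close>

lemma noise_second_moment:
  fixes \<xi> :: "'w \<Rightarrow> real^'n"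
  assumes "uncorrelated_noise M \<xi> \<sigma>"
  shows "integrable M (\<lambda>\<omega>. (u \<bullet> \<xi> \<omega>)\<^sup>2)"
    and "(\<integral>\<omega>. (u \<bullet> \<xi> \<omega>)\<^sup>2 \<partial>M) = \<sigma>\<^sup>2 * (norm u)\<^sup>2"
proof -
  have [measurable]: "\<xi> \<in> borel_measurable M"
    and sq: "\<And>i. integrable M (\<lambda>\<omega>. (\<xi> \<omega> $ i)\<^sup>2)"
    and mean: "\<And>i. (\<integral>\<omega>. \<xi> \<omega> $ i \<partial>M) = 0"
    using assms unfolding uncorrelated_noise_def by auto
  have [measurable]: "(\<lambda>\<omega>. \<xi> \<omega> $ i) \<in> borel_measurable M" for i
    by (rule borel_measurable_continuous_on[where f = "\<lambda>x. x $ i"])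
      (auto intro: continuous_intros)
  \<comment> \<open>With zero means, variances and covariances are plain second moments.\<close>
  have var: "(\<integral>\<omega>. \<xi> \<omega> $ i * \<xi> \<omega> $ j \<partial>M) = (if i = j then \<sigma>\<^sup>2 else 0)" for i j
    using assms mean unfolding uncorrelated_noise_def by (auto simp: power2_eq_square)
  \<comment> \<open>Products are dominated by the integrable sum of squares.\<close>
  have int: "integrable M (\<lambda>\<omega>. \<xi> \<omega> $ i * \<xi> \<omega> $ j)" for i j
  proof (rule Bochner_Integration.integrable_bound)
    show "integrable M (\<lambda>\<omega>. (\<xi> \<omega> $ i)\<^sup>2 + (\<xi> \<omega> $ j)\<^sup>2)" using sq by simp
    have "\<bar>x * y\<bar> \<le> x\<^sup>2 + y\<^sup>2" for x y :: real
    proof -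
      have "2 * \<bar>x * y\<bar> \<le> x\<^sup>2 + y\<^sup>2"
        using sum_squares_bound[of "\<bar>x\<bar>" "\<bar>y\<bar>"] by (simp add: abs_mult)
      then show ?thesis using abs_ge_zero[of "x * y"] by linarith
    qed
    then show "AE \<omega> in M. norm (\<xi> \<omega> $ i * \<xi> \<omega> $ j) \<le> norm ((\<xi> \<omega> $ i)\<^sup>2 + (\<xi> \<omega> $ j)\<^sup>2)"
      by simp
  qed measurable
  have expand: "(u \<bullet> \<xi> \<omega>)\<^sup>2 = (\<Sum>i\<in>UNIV. \<Sum>j\<in>UNIV. (u $ i * u $ j) * (\<xi> \<omega> $ i * \<xi> \<omega> $ j))"
    for \<omega>
    by (simp add: inner_vec_def power2_eq_square sum_product mult_ac)
  show "integrable M (\<lambda>\<omega>. (u \<bullet> \<xi> \<omega>)\<^sup>2)"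
    unfolding expand using int by simp
  have "(\<integral>\<omega>. (u \<bullet> \<xi> \<omega>)\<^sup>2 \<partial>M) = (\<Sum>i\<in>UNIV. \<Sum>j\<in>UNIV. (u $ i * u $ j) * (if i = j then \<sigma>\<^sup>2 else 0))"
    unfolding expand using int by (simp add: Bochner_Integration.integral_sum var)
  also have "\<dots> = \<sigma>\<^sup>2 * (norm u)\<^sup>2"
    by (simp add: power2_norm_eq_inner inner_vec_def sum_distrib_left if_distrib mult_ac
        cong: if_cong)
  finally show "(\<integral>\<omega>. (u \<bullet> \<xi> \<omega>)\<^sup>2 \<partial>M) = \<sigma>\<^sup>2 * (norm u)\<^sup>2" .
qed

text \<open>What \<open>proj_mat X\<close> removes from \<open>x\<close> is orthogonal to the
  smaller column space as well.\<close>

lemma proj_mat_proj_mat: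
  fixes A :: "real^'m^'n" and X :: "real^'d^'n"
  assumes "span (columns A) \<subseteq> span (columns X)"
  shows "proj_mat A *v (proj_mat X *v x) = proj_mat A *v x"
proof (rule sym, rule proj_mat_eqI)
  fix z assume z: "z \<in> span (columns A)"
  have "orthogonal (x - proj_mat X *v x) z"
    using assms z by (intro proj_mat(2)) auto
  moreover have "orthogonal (proj_mat X *v x - proj_mat A *v (proj_mat X *v x)) z"
    using z by (rule proj_mat(2))
  ultimately show "orthogonal (x - proj_mat A *v (proj_mat X *v x)) z"
    by (simp add: orthogonal_def inner_diff_left)
qed (rule proj_mat(1))

text \<open>Bias and variance are orthogonal already before taking expectations.\<close>

lemma excess_risk_eq:
  fixes X :: "real^'d^'n" and S :: "real^'k^'d" and \<xi> :: "'w \<Rightarrow> real^'n"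
  assumes "prob_space M" and noise: "uncorrelated_noise M \<xi> \<sigma>"
    and w: "min_norm_solution X f wstar"
    and ls: "\<And>y. least_squares_solution (X ** S) y (what S y)"
  shows "excess_risk M X f \<xi> wstar what S =
    ((norm ((mat 1 - proj_mat (X ** S)) ** X *v wstar))\<^sup>2
      + \<sigma>\<^sup>2 * (norm (proj_mat (X ** S)))\<^sup>2) / real CARD('n)"
proof -
  interpret prob_space M by fact
  let ?P = "proj_mat (X ** S)"
  let ?b = "(mat 1 - ?P) ** X *v wstar"
  have Xw: "X *v wstar = proj_mat X *v f"
    using w by (simp add: min_norm_solution_def is_arg_min_def)
  have b: "?b = X *v wstar - ?P *v (X *v wstar)"
    by (simp only: matrix_vector_mul_assoc[symmetric] matrix_vector_mult_diff_rdistrib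
        matrix_vector_mul_lid)
  \<comment> \<open>\<open>X *v wstar\<close> is only the projection of \<open>f\<close>, but the
    part of \<open>f\<close> orthogonal to the columns of \<open>X\<close> is invisible to
    \<open>?P\<close>. So the noise-free error is exactly the bias \<open>?b\<close>.\<close>
  have "?P *v f = ?P *v (X *v wstar)"
    unfolding Xw by (rule proj_mat_proj_mat[OF span_columns_mult, symmetric])
  then have err: "X *v wstar - (X ** S) *v what S (f + \<xi> \<omega>) = ?b - ?P *v \<xi> \<omega>" for \<omega>
    using ls[of "f + \<xi> \<omega>"]
    by (simp only: least_squares_solution_def b matrix_vector_right_distrib) simp
  have "(norm (?b - ?P *v \<xi> \<omega>))\<^sup>2 = (norm ?b)\<^sup>2 + (norm (?P *v \<xi> \<omega>))\<^sup>2" for \<omega>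
  proof -
    have "orthogonal ?b (?P *v \<xi> \<omega>)"
      unfolding b by (intro proj_mat(2) proj_mat(1))
    then show ?thesis
      by (simp only: orthogonal_def power2_norm_eq_inner inner_diff_left inner_diff_right
          inner_commute[of "?P *v \<xi> \<omega>" ?b])
  qed
  \<comment> \<open>This reduces the variance to second moments along the rows of \<open>?P\<close>,
    which add up to \<open>\<sigma>\<^sup>2\<close> times its squared Frobenius norm.\<close>
  moreover have "(norm (?P *v \<xi> \<omega>))\<^sup>2 = (\<Sum>i\<in>UNIV. (?P $ i \<bullet> \<xi> \<omega>)\<^sup>2)" for \<omega>
    unfolding power2_norm_eq_inner inner_vec_def[of "?P *v _"]
    by (simp add: matrix_vector_mul_component power2_eq_square)
  ultimately have sq: "(norm (X *v wstar - (X ** S) *v what S (f + \<xi> \<omega>)))\<^sup>2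
      = (norm ?b)\<^sup>2 + (\<Sum>i\<in>UNIV. (?P $ i \<bullet> \<xi> \<omega>)\<^sup>2)" for \<omega>
    unfolding err by (simp only:)
  have "(\<integral>\<omega>. (norm ?b)\<^sup>2 + (\<Sum>i\<in>UNIV. (?P $ i \<bullet> \<xi> \<omega>)\<^sup>2) \<partial>M)
      = (norm ?b)\<^sup>2 + (\<Sum>i\<in>UNIV. \<sigma>\<^sup>2 * (norm (?P $ i))\<^sup>2)"
    using noise_second_moment[OF noise]
    by (simp add: Bochner_Integration.integral_add Bochner_Integration.integral_sum prob_space)
  then show ?thesis
    unfolding excess_risk_def sq norm_matrix_rows[of ?P] sum_distrib_left by simp
qed

section \<open>Combining the random events with the risk bound\<close>

theorem theorem1:
  fixes M :: "'w measure"
    and X T :: "real^'d^'n"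
    and R :: "'w \<Rightarrow> real^'k^'d"
    and f :: "real^'n"
    and \<xi> :: "'w \<Rightarrow> real^'n"
    and wstar :: "real^'d"
    and what :: "real^'k^'d \<Rightarrow> real^'n \<Rightarrow> real^'k"
    and r :: nat
    and \<sigma> \<epsilon>1 \<epsilon>2 \<delta>1 \<delta>2 :: real
  assumes "prob_space M"
    and "rank X = min CARD('d) CARD('n)"
    and "R \<in> borel_measurable M"
    and "uncorrelated_noise M \<xi> \<sigma>"
    and "prob_space.indep_set M (sets (vimage_algebra (space M) R borel))
           (sets (vimage_algebra (space M) \<xi> borel))"
    and "min_norm_solution X f wstar"
    and "\<And>S y. least_squares_solution (X ** S) y (what S y)"
    and "1 \<le> r" and "r \<le> min CARD('d) CARD('n)"
    and "truncated_svd r X T"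
    and "JLT M R (2 * CARD('n) * r) (\<epsilon>1 / sqrt (real r)) \<delta>1"
    and "restricted_isometry M R r \<epsilon>2 \<delta>2"
  shows "measure M {\<omega> \<in> space M.
             (norm ((mat 1 - proj_mat (X ** R \<omega>)) ** X))\<^sup>2
               \<le> (1 + \<epsilon>1\<^sup>2 / (1 - \<epsilon>2) ^ 4) * (norm (X - T))\<^sup>2} \<ge> 1 - \<delta>1 - \<delta>2
       \<and> (\<forall>\<omega> \<in> space M.
             (norm ((mat 1 - proj_mat (X ** R \<omega>)) ** X))\<^sup>2
               \<le> (1 + \<epsilon>1\<^sup>2 / (1 - \<epsilon>2) ^ 4) * (norm (X - T))\<^sup>2
             \<longrightarrow> excess_risk M X f \<xi> wstar what (R \<omega>)
               \<le> (1 + \<epsilon>1\<^sup>2 / (1 - \<epsilon>2) ^ 4) * (norm wstar)\<^sup>2 * ((norm (X - T))\<^sup>2 / real CARD('n))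
                 + \<sigma>\<^sup>2 * (real CARD('k) / real CARD('n)))"
proof
  interpret prob_space M by fact
  let ?c = "1 + \<epsilon>1\<^sup>2 / (1 - \<epsilon>2) ^ 4"
  let ?h = "\<lambda>S. (norm ((mat 1 - proj_mat (X ** S)) ** X))\<^sup>2"
  have \<epsilon>: "0 < \<epsilon>1 / sqrt (real r)" "\<delta>1 < 1" "\<epsilon>2 < 1" "\<delta>2 < 1"
    using assms(11,12) by (simp_all add: JLT_def restricted_isometry_def)
  obtain v where v: "\<And>i j. i < r \<Longrightarrow> j < r \<Longrightarrow> v i \<bullet> v j = (if i = j then 1 else 0)"
      "\<And>a. T $ a \<in> span (v ` {..<r})"
      "\<And>a j. j < r \<Longrightarrow> (X - T) $ a \<bullet> v j = 0"
    using truncated_svd_right_vectors[OF assms(10,9)] by blast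
  let ?V = "span (v ` {..<r})"
  \<comment> \<open>One index for each row of \<open>X - T\<close>, each singular vector and each
    sign: exactly the \<open>2 * CARD('n) * r\<close> points of the \<open>JLT\<close> hypothesis,
    numbered by \<open>g\<close>.\<close>
  let ?I = "(UNIV :: 'n set) \<times> {..<r} \<times> (UNIV :: bool set)"
  have "finite ?I" and card: "card ?I = 2 * CARD('n) * r" by (simp_all add: card_cartesian_product)
  then obtain g where g: "bij_betw g {0..<2 * CARD('n) * r} ?I"
    using ex_bij_betw_nat_finite[OF \<open>finite ?I\<close>, unfolded card] by blast
  define pt where "pt = (\<lambda>(a, j, b). if b then sgn ((X - T) $ a) + v j else sgn ((X - T) $ a) - v j)"
  define A where "A = {\<omega> \<in> space M. \<forall>i < 2 * CARD('n) * r.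
    (1 - \<epsilon>1 / sqrt (real r)) * (norm (pt (g i)))\<^sup>2 \<le> (norm (transpose (R \<omega>) *v pt (g i)))\<^sup>2 \<and>
    (norm (transpose (R \<omega>) *v pt (g i)))\<^sup>2 \<le> (1 + \<epsilon>1 / sqrt (real r)) * (norm (pt (g i)))\<^sup>2}"
  define B where "B = {\<omega> \<in> space M. \<forall>x \<in> ?V.
    (1 - \<epsilon>2) * norm x \<le> norm (transpose (R \<omega>) *v x) \<and>
    norm (transpose (R \<omega>) *v x) \<le> (1 + \<epsilon>2) * norm x}"
  \<comment> \<open>The points \<open>pt (g i)\<close> and the subspace \<open>?V\<close> come from
    the singular value decomposition of \<open>X\<close> alone, so they are fixed before
    \<open>\<omega>\<close>, as both hypotheses demand.\<close>
  have "1 - \<delta>1 \<le> prob A"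
    using assms(11) unfolding JLT_def A_def
    by (elim conjE) (erule allE[where x = "\<lambda>i. pt (g i)"])
  moreover have "1 - \<delta>2 \<le> prob B"
    using assms(12) dim_span_orthonormal[OF v(1)] subspace_span
    unfolding restricted_isometry_def B_def by blast
  moreover have "{\<omega> \<in> space M. ?h (R \<omega>) \<le> ?c * (norm (X - T))\<^sup>2} \<in> events"
  proof -
    have [measurable]: "R \<in> borel_measurable M" by fact
    show ?thesis by measurable
  qed
  moreover have "A \<inter> B \<subseteq> {\<omega> \<in> space M. ?h (R \<omega>) \<le> ?c * (norm (X - T))\<^sup>2}"
  proof
    fix \<omega> assume \<omega>: "\<omega> \<in> A \<inter> B"
    have pt: "(1 - \<epsilon>1 / sqrt (real r)) * (norm (pt q))\<^sup>2 \<le> (norm (transpose (R \<omega>) *v pt q))\<^sup>2"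
      "(norm (transpose (R \<omega>) *v pt q))\<^sup>2 \<le> (1 + \<epsilon>1 / sqrt (real r)) * (norm (pt q))\<^sup>2"
      if "q \<in> ?I" for q
    proof -
      have "q \<in> g ` {0..<2 * CARD('n) * r}"
        using that unfolding bij_betw_imp_surj_on[OF g] .
      then obtain i where "i < 2 * CARD('n) * r" "q = g i" by auto
      then show "(1 - \<epsilon>1 / sqrt (real r)) * (norm (pt q))\<^sup>2 \<le> (norm (transpose (R \<omega>) *v pt q))\<^sup>2"
        "(norm (transpose (R \<omega>) *v pt q))\<^sup>2 \<le> (1 + \<epsilon>1 / sqrt (real r)) * (norm (pt q))\<^sup>2"
        using \<omega> unfolding A_def by blast+
    qed
    have "?h (R \<omega>) \<le> (1 + real r * (\<epsilon>1 / sqrt (real r))\<^sup>2 / (1 - \<epsilon>2) ^ 4) * (norm (X - T))\<^sup>2"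
    proof (rule sketch_residual_le[where v = v])
      show "(1 - \<epsilon>2) * norm x \<le> norm (transpose (R \<omega>) *v x)" if "x \<in> ?V" for x
        using \<omega> that unfolding B_def by blast
      show "\<bar>(transpose (R \<omega>) *v ((X - T) $ a)) \<bullet> (transpose (R \<omega>) *v v j)\<bar>
          \<le> \<epsilon>1 / sqrt (real r) * norm ((X - T) $ a)" if "j < r" for a j
        using pt[of "(a, j, True)"] pt[of "(a, j, False)"] that v(1)[of j j] v(3)[of j a]
        by (intro JLT_cross_bound) (simp_all add: pt_def norm_eq_1)
    qed (use v \<epsilon> in auto)
    \<comment> \<open>The factor \<open>1 / sqrt (real r)\<close> in the accuracy pays for summing
      over \<open>r\<close> singular vectors.\<close>
    also have "real r * (\<epsilon>1 / sqrt (real r))\<^sup>2 = \<epsilon>1\<^sup>2"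
      using \<open>1 \<le> r\<close> by (simp add: power_divide)
    finally show "\<omega> \<in> {\<omega> \<in> space M. ?h (R \<omega>) \<le> ?c * (norm (X - T))\<^sup>2}"
      using \<omega> by (simp add: A_def)
  qed
  ultimately show "1 - \<delta>1 - \<delta>2 \<le> prob {\<omega> \<in> space M. ?h (R \<omega>) \<le> ?c * (norm (X - T))\<^sup>2}"
    using \<epsilon> by (intro prob_Int_ge)
  show "\<forall>\<omega> \<in> space M. ?h (R \<omega>) \<le> ?c * (norm (X - T))\<^sup>2 \<longrightarrow>
      excess_risk M X f \<xi> wstar what (R \<omega>)
        \<le> ?c * (norm wstar)\<^sup>2 * ((norm (X - T))\<^sup>2 / real CARD('n))
          + \<sigma>\<^sup>2 * (real CARD('k) / real CARD('n))"
  proof (intro ballI impI)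
    fix \<omega> assume h: "?h (R \<omega>) \<le> ?c * (norm (X - T))\<^sup>2"
    let ?P = "proj_mat (X ** R \<omega>)"
    have "(norm ((mat 1 - ?P) ** X *v wstar))\<^sup>2 \<le> ?h (R \<omega>) * (norm wstar)\<^sup>2"
      by (rule norm_matrix_vector_le_Frobenius)
    also have "\<dots> \<le> ?c * (norm (X - T))\<^sup>2 * (norm wstar)\<^sup>2"
      by (rule mult_right_mono[OF h]) simp
    \<comment> \<open>The bias is bounded through the residual, the variance through the rank of
      \<open>?P\<close>.\<close>
    finally have "(norm ((mat 1 - ?P) ** X *v wstar))\<^sup>2 + \<sigma>\<^sup>2 * (norm ?P)\<^sup>2
        \<le> ?c * (norm (X - T))\<^sup>2 * (norm wstar)\<^sup>2 + \<sigma>\<^sup>2 * real CARD('k)"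
      by (intro add_mono mult_left_mono norm_proj_mat_le) simp_all
    then have "excess_risk M X f \<xi> wstar what (R \<omega>)
        \<le> (?c * (norm (X - T))\<^sup>2 * (norm wstar)\<^sup>2 + \<sigma>\<^sup>2 * real CARD('k)) / real CARD('n)"
      unfolding excess_risk_eq[OF assms(1,4,6,7)] by (rule divide_right_mono) simp
    then show "excess_risk M X f \<xi> wstar what (R \<omega>)
        \<le> ?c * (norm wstar)\<^sup>2 * ((norm (X - T))\<^sup>2 / real CARD('n))
          + \<sigma>\<^sup>2 * (real CARD('k) / real CARD('n))"
      by (simp only: add_divide_distrib times_divide_eq_right times_divide_eq_left mult_ac)
  qed
qed

end
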